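(* Let $T>0$ and let $H:[0,T]\to(1/2,1)$ be measurable. Then the function $R_H^T:[0,T]\times[0,T]\to\mathbb{R}$ is positive semidefinite, i.e. for all $n\ge 1$, all $t_1,\dots,t_n\in[0,T]$ and all $\alpha_1,\dots,\alpha_n\in\mathbb{R}$, $$\sum_{i,j=1}^n\alpha_i\alpha_jR_H^T(t_i,t_j)\ge 0 .$$
   Context: $\beta(\cdot,\cdot)$ denotes the Beta function, and for $h\in(1/2,1)$ set $c_h=\left(\frac{h(2h-1)}{\beta(2-2h,\,h-1/2)}\right)^{1/2}$. For $T>0$ and $H:[0,T]\to(1/2,1)$ write $H_t=H(t)$ and, for $s,t\in[0,T]$, $$K_H(t,s)=\left[c_{H_t}s^{\frac12-H_t}\int_s^t(u-s)^{H_t-\frac32}u^{H_t-\frac12}\,du\right]\mathbf 1_{[0,t]}(s),$$ $$R_H^T(t,s)=\int_0^{s\wedge t}K_H(t,u)K_H(s,u)\,du .$$ *)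

theory Defs
  imports "HOL-Analysis.Analysis"
begin

definition c_const :: "real \<Rightarrow> real" where
  "c_const h = sqrt (h * (2 * h - 1) / Beta (2 - 2 * h) (h - 1 / 2))"

(* Lebesgue integrals throughout.  At s = 0 the factor s powr (1/2 - H t) is 0 powr of a negative
   exponent, hence 0 by the library convention, while the mathematical expression is undefined
   there; likewise the integrand at u = s.  Both concern single points only, so neither integral
   depends on these values. *)
definition K_kernel :: "(real \<Rightarrow> real) \<Rightarrow> real \<Rightarrow> real \<Rightarrow> real" where
  "K_kernel H t s =
     (c_const (H t) * s powr (1 / 2 - H t) *
       (LBINT u:{s..t}. (u - s) powr (H t - 3 / 2) * u powr (H t - 1 / 2))) * indicator {0..t} s"

(* The horizon T enters only as the domain of the two time arguments, so it is not a parameter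
   here but the set on which positive semidefiniteness is asserted. *)
definition R_cov :: "(real \<Rightarrow> real) \<Rightarrow> real \<Rightarrow> real \<Rightarrow> real" where
  "R_cov H t s = (LBINT u:{0..min s t}. K_kernel H t u * K_kernel H s u)"

definition positive_semidefinite_on :: "'a set \<Rightarrow> ('a \<Rightarrow> 'a \<Rightarrow> real) \<Rightarrow> bool" where
  "positive_semidefinite_on S R \<longleftrightarrow>
     (\<forall>n\<ge>1. \<forall>(t :: nat \<Rightarrow> 'a) (\<alpha> :: nat \<Rightarrow> real). (\<forall>i\<in>{1..n}. t i \<in> S) \<longrightarrow>
        (\<Sum>i=1..n. \<Sum>j=1..n. \<alpha> i * \<alpha> j * R (t i) (t j)) \<ge> 0)"

end

theory Submission
  imports Defs
begin

text \<open>
  The kernel \<open>K_kernel H t\<close> vanishes outside \<open>{0..t}\<close>, so integrating a product of two kernels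
  over \<open>{0..min s t}\<close> is the same as integrating it over the whole line:
  \<open>R_cov H\<close> is a Gram kernel of vectors in the real Hilbert space $L^2$, and its quadratic form is
  the integral of \<open>(\<Sum>i. \<alpha> i * K_kernel H (t i) u)\<^sup>2\<close>
  (\<open>R_cov_eq_inner_product\<close>, \<open>gram_form_nonneg\<close>).

  Expanding that square under the integral requires each kernel to be square integrable; this
  is the analytic content, in \<open>kernel_square_integrable\<close>. Write \<open>h\<close> for \<open>H t\<close>. In the inner integral
  the increasing factor \<open>u powr (h - 1/2)\<close> is at most \<open>t powr (h - 1/2)\<close>, and the singularity
  \<open>(u - s) powr (h - 3/2)\<close> is integrable because \<open>h > 1/2\<close>, so the inner integral is bounded
  uniformly in \<open>s\<close>. What remains is a constant times \<open>s powr (1/2 - h)\<close>, whose square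
  \<open>s powr (1 - 2 * h)\<close> is integrable at \<open>0\<close> because \<open>h < 1\<close>. Only one value of \<open>H\<close> enters each
  kernel, so the argument treats the times \<open>t i\<close> one by one.
\<close>

lemma powr_integrable_lborel:
  fixes a c :: real
  assumes "a > -1" "c \<ge> 0"
  shows "integrable lborel (\<lambda>x. indicator {0..c} x * x powr a)"
proof -
  have "(\<lambda>x. x powr a) absolutely_integrable_on {0..c}"
    using integrable_on_powr_from_0[OF assms] by (intro nonnegative_absolutely_integrable_1) auto
  \<comment> \<open>Absolute integrability is stated for the completed measure; for a Borel integrand it
     descends to \<open>lborel\<close>.\<close>
  then have "set_integrable lborel {0..c} (\<lambda>x. x powr a)"
    unfolding set_integrable_def by (subst (asm) integrable_completion) auto
  then show ?thesis
    by (simp add: set_integrable_def)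
qed

text \<open>
  The variable \<open>s\<close> occurs both in the integrand and in the domain of the inner integral. Turning
  the domain into a condition gives a jointly Borel integrand on the plane, and a parametric
  integral of such a function is Borel in the parameter.
\<close>
lemma kernel_measurable: "K_kernel H t \<in> borel_measurable lborel"
proof -
  have "(\<lambda>s. LBINT u. (if s \<le> u \<and> u \<le> t then (u - s) powr (H t - 3 / 2) * u powr (H t - 1 / 2) else 0))
          \<in> borel_measurable lborel"
    by measurable
  then have [measurable]:
    "(\<lambda>s. LBINT u:{s..t}. (u - s) powr (H t - 3 / 2) * u powr (H t - 1 / 2)) \<in> borel_measurable lborel"
    unfolding set_lebesgue_integral_def
    by (rule measurable_cong[THEN iffD1, rotated]) (auto intro!: Bochner_Integration.integral_cong)
  show ?thesis
    unfolding K_kernel_def[abs_def] by measurable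
qed

text \<open>
  The bound does not depend on \<open>s\<close>: after \<open>u powr (h - 1/2)\<close> is replaced by its maximum, translation
  by \<open>s\<close> turns the rest into an integral of \<open>v powr (h - 3/2)\<close> over \<open>{0..t - s}\<close>, which is enlarged to
  \<open>{0..t}\<close>.
\<close>
lemma inner_integral_bounded:
  fixes h t :: real
  assumes "1/2 < h" "0 \<le> t"
  obtains C where "\<And>s. 0 \<le> s \<Longrightarrow>
    \<bar>LBINT u:{s..t}. (u - s) powr (h - 3/2) * u powr (h - 1/2)\<bar> \<le> C"
proof
  fix s :: real assume s: "0 \<le> s"
  define p where "p v = indicator {0..t} v * v powr (h - 3/2)" for v :: real
  have p: "integrable lborel p"
    unfolding p_def using powr_integrable_lborel[of "h - 3/2" t] assms by simp
  have ps: "integrable lborel (\<lambda>u. p (u - s))" "(LBINT u. p (u - s)) = (LBINT v. p v)"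
    using lborel_integrable_real_affine[OF p, of 1 "-s"]
      lborel_integral_real_affine[of 1 p "-s"] by simp_all
  have "(LBINT u:{s..t}. (u - s) powr (h - 3/2) * u powr (h - 1/2))
      \<le> (LBINT u. t powr (h - 1/2) * p (u - s))"
    unfolding set_lebesgue_integral_def
  proof (rule integral_mono')
    fix u :: real
    show "indicator {s..t} u *\<^sub>R ((u - s) powr (h - 3/2) * u powr (h - 1/2))
        \<le> t powr (h - 1/2) * p (u - s)"
    proof (cases "u \<in> {s..t}")
      case True
      then have "u powr (h - 1/2) \<le> t powr (h - 1/2)"
        using s assms by (intro powr_mono2) auto
      then show ?thesis
        using True s by (auto simp: p_def mult.commute intro!: mult_right_mono)
    qed (simp add: p_def)
  qed (use ps in \<open>auto simp: p_def\<close>)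
  moreover have "0 \<le> (LBINT u:{s..t}. (u - s) powr (h - 3/2) * u powr (h - 1/2))"
    unfolding set_lebesgue_integral_def by (intro integral_nonneg_AE) auto
  ultimately show "\<bar>LBINT u:{s..t}. (u - s) powr (h - 3/2) * u powr (h - 1/2)\<bar>
      \<le> t powr (h - 1/2) * (LBINT v. indicator {0..t} v * v powr (h - 3/2))"
    using ps(2) by (simp add: p_def)
qed

text \<open>
  The only unbounded factor of the kernel is \<open>s powr (1/2 - H t)\<close>, and its square has exponent
  \<open>1 - 2 * H t > -1\<close>.
\<close>
lemma kernel_square_integrable:
  assumes "0 \<le> t" "H t \<in> {1/2<..<1}"
  shows "integrable lborel (\<lambda>s. (K_kernel H t s)\<^sup>2)"
proof -
  define J where "J s = (LBINT u:{s..t}. (u - s) powr (H t - 3/2) * u powr (H t - 1/2))" for s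
  obtain C where C: "\<And>s. 0 \<le> s \<Longrightarrow> \<bar>J s\<bar> \<le> C"
    using inner_integral_bounded[of "H t" t] assms unfolding J_def by auto
  have "integrable lborel (\<lambda>s. (c_const (H t) * C)\<^sup>2 * (indicator {0..t} s * s powr (1 - 2 * H t)))"
    using assms by (intro integrable_mult_right powr_integrable_lborel) auto
  then show ?thesis
  proof (rule Bochner_Integration.integrable_bound)
    show "(\<lambda>s. (K_kernel H t s)\<^sup>2) \<in> borel_measurable lborel"
      using kernel_measurable by measurable
    show "AE s in lborel. norm ((K_kernel H t s)\<^sup>2)
        \<le> norm ((c_const (H t) * C)\<^sup>2 * (indicator {0..t} s * s powr (1 - 2 * H t)))"
    proof (rule AE_I2)
      fix s :: real
      show "norm ((K_kernel H t s)\<^sup>2)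
        \<le> norm ((c_const (H t) * C)\<^sup>2 * (indicator {0..t} s * s powr (1 - 2 * H t)))"
      proof (cases "s \<in> {0..t}")
        case True
        have "(K_kernel H t s)\<^sup>2 = (c_const (H t))\<^sup>2 * (s powr (1/2 - H t))\<^sup>2 * (J s)\<^sup>2"
          using True by (simp add: K_kernel_def J_def power_mult_distrib)
        also have "(s powr (1/2 - H t))\<^sup>2 = s powr (1 - 2 * H t)"
          by (simp add: power2_eq_square flip: powr_add)
        also have "(c_const (H t))\<^sup>2 * s powr (1 - 2 * H t) * (J s)\<^sup>2
            \<le> (c_const (H t))\<^sup>2 * s powr (1 - 2 * H t) * C\<^sup>2"
          using power_mono[OF C[of s], of 2] True by (intro mult_left_mono) auto
        finally show ?thesis
          using True by (simp add: power_mult_distrib mult_ac)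
      qed (simp add: K_kernel_def)
    qed
  qed
qed

text \<open>The integrability half of the Cauchy-Schwarz inequality, by \<open>2 * \<bar>a * b\<bar> \<le> a\<^sup>2 + b\<^sup>2\<close>.\<close>
lemma integrable_mult_of_square_integrable:
  fixes f g :: "'a \<Rightarrow> real"
  assumes [measurable]: "f \<in> borel_measurable M" "g \<in> borel_measurable M"
    and "integrable M (\<lambda>x. (f x)\<^sup>2)" "integrable M (\<lambda>x. (g x)\<^sup>2)"
  shows "integrable M (\<lambda>x. f x * g x)"
proof (rule Bochner_Integration.integrable_bound)
  show "integrable M (\<lambda>x. (f x)\<^sup>2 + (g x)\<^sup>2)"
    using assms by simp
  have "\<bar>a * b\<bar> \<le> a\<^sup>2 + b\<^sup>2" for a b :: real
  proof -
    have "2 * (\<bar>a\<bar> * \<bar>b\<bar>) \<le> a\<^sup>2 + b\<^sup>2"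
      using sum_squares_bound[of "\<bar>a\<bar>" "\<bar>b\<bar>"] by simp
    moreover have "0 \<le> \<bar>a\<bar> * \<bar>b\<bar>" by simp
    ultimately show ?thesis unfolding abs_mult by linarith
  qed
  then show "AE x in M. norm (f x * g x) \<le> norm ((f x)\<^sup>2 + (g x)\<^sup>2)"
    by (intro AE_I2) simp
qed measurable

text \<open>
  Gram matrices are positive semidefinite: the form is the squared $L^2$ norm of \<open>\<Sum>i\<in>I. \<alpha> i * f i\<close>.
  Square integrability is what makes the integral additive here; a Bochner integral of a
  non-integrable product would be \<open>0\<close> by convention and break the expansion.
\<close>
lemma gram_form_nonneg:
  fixes f :: "'i \<Rightarrow> 'a \<Rightarrow> real" and \<alpha> :: "'i \<Rightarrow> real"
  assumes "\<And>i. i \<in> I \<Longrightarrow> f i \<in> borel_measurable M"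
    and "\<And>i. i \<in> I \<Longrightarrow> integrable M (\<lambda>x. (f i x)\<^sup>2)"
  shows "0 \<le> (\<Sum>i\<in>I. \<Sum>j\<in>I. \<alpha> i * \<alpha> j * (LINT x|M. f i x * f j x))"
proof -
  have int: "integrable M (\<lambda>x. \<alpha> i * \<alpha> j * (f i x * f j x))" if "i \<in> I" "j \<in> I" for i j
    using that assms by (intro integrable_mult_right integrable_mult_of_square_integrable) auto
  have "(\<Sum>i\<in>I. \<Sum>j\<in>I. \<alpha> i * \<alpha> j * (LINT x|M. f i x * f j x))
      = (LINT x|M. (\<Sum>i\<in>I. \<Sum>j\<in>I. \<alpha> i * \<alpha> j * (f i x * f j x)))"
    using int by (simp add: Bochner_Integration.integral_sum)
  also have "\<dots> = (LINT x|M. (\<Sum>i\<in>I. \<alpha> i * f i x)\<^sup>2)"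
    by (simp add: power2_eq_square sum_product mult_ac)
  finally show ?thesis by simp
qed

lemma R_cov_eq_inner_product:
  "R_cov H t s = (LBINT u. K_kernel H t u * K_kernel H s u)"
  unfolding R_cov_def set_lebesgue_integral_def
  by (intro Bochner_Integration.integral_cong) (auto simp: K_kernel_def indicator_def)

theorem theorem2p0p1:
  fixes T :: real and H :: "real \<Rightarrow> real"
  assumes "T > 0"
    and "H \<in> {0..T} \<rightarrow> {1/2<..<1}"
    and "H \<in> borel_measurable (lebesgue_on {0..T})"
  shows "positive_semidefinite_on {0..T} (R_cov H)"
  unfolding positive_semidefinite_on_def R_cov_eq_inner_product
proof (intro allI impI)
  fix n :: nat and t \<alpha> :: "nat \<Rightarrow> real"
  assume t: "\<forall>i\<in>{1..n}. t i \<in> {0..T}"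
  show "0 \<le> (\<Sum>i=1..n. \<Sum>j=1..n. \<alpha> i * \<alpha> j * (LBINT u. K_kernel H (t i) u * K_kernel H (t j) u))"
  proof (intro gram_form_nonneg kernel_measurable kernel_square_integrable)
    fix i assume "i \<in> {1..n}"
    then have "t i \<in> {0..T}" using t by blast
    then show "0 \<le> t i" "H (t i) \<in> {1/2<..<1}"
      using assms(2) by auto
  qed
qed

end
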